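(* Let $c_{3,0},c_{0,0},c_{0,1}\in\mathbb R$ with $c_{3,0}\ne0$, $c_{0,1}\neq 0$, and let $L_3=c_{3,0}D^3+c_{0,0}+c_{0,1}x$, with Heat--Airy transport $$N_3=(c_{0,0}+c_{0,1}x)+c_{0,1}tD-c_{0,1}sD^2+c_{3,0}D^3 .$$ Let $I\subset\mathbb R^2$ be open, $f:I\to\mathbb R$ smooth, and $v$ smooth on $I\times\mathbb R$ with $v_t=\frac12v_{xx}$, $v_s=-\frac13v_{xxx}$, $N_3v=0$, $v(t,s,f(t,s))=0$, and $v_x(t,s,f(t,s))\ne0$ on $I$. Let $F(t)=f(t,0)$ for $(t,0)\in I$. Then the compatibility equation of the pure Heat problem for $L_3$ is recovered sequentially from the first two Heat--Airy spatial-jet compatibility relations on the slice $s=0$. More precisely, the first Heat--Airy relation $$3c_{3,0}f_s+2c_{0,1}sf_t+c_{0,1}t=0$$ gives $$f_s(t,0)=-\frac{c_{0,1}}{3c_{3,0}}\,t ,$$ and substituting this into the second Heat--Airy relation $$c_{0,0}+c_{0,1}f-2c_{0,1}tf_t-3c_{0,1}sf_s-4c_{3,0}f_{tt}+8c_{3,0}(f_t)^3-12c_{3,0}f_tf_s=0$$ at $s=0$ yields $$c_{0,0}+c_{0,1}F+2c_{0,1}tF'+8c_{3,0}(F')^3-4c_{3,0}F''=0,$$ which is the pure Heat compatibility equation $\det M_3^H(F;t)=0$.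
   Context: $D=\partial/\partial x$, and $v^{(k)}=\partial_x^kv$. $N_3=P_{t,s}L_3P_{t,s}^{-1}$ with $P_{t,s}=\exp(\frac t2D^2-\frac s3D^3)$; conjugation fixes $D$ and sends $x$ to $x+tD-sD^2$. The first and second Heat--Airy compatibility relations are the restrictions of $N_3v=0$ and of $D(N_3v)=0$ to $x=f(t,s)$, rewritten using the identities (valid at $x=f(t,s)$) $v^{(0)}=0$, $v^{(2)}=-2f_tv^{(1)}$, $v^{(3)}=3f_sv^{(1)}$, $v^{(4)}=[-4f_{tt}+8(f_t)^3-12f_tf_s]v^{(1)}$ and divided by $v^{(1)}\neq0$; their explicit forms are those given in the claim. The pure Heat compatibility equation for $L_3$ is $\det M_3^H(F;t)=0$ with $$M_3^H(F;t)=\begin{pmatrix}0&c_{3,0}&0&c_{0,1}t\\0&0&1&2F'\\1&4F'&4(F')^2&4F''\\c_{3,0}&0&c_{0,1}t&c_{0,0}+c_{0,1}F\end{pmatrix},$$ which acts on the boundary jet $(v^{(4)},v^{(3)},v^{(2)},v^{(1)})^{\mathsf T}$ at $x=F(t)$ and collects the restrictions of $N_3^Hv=0$ and $D(N_3^Hv)=0$, where $N_3^H=(c_{0,0}+c_{0,1}x)+c_{0,1}tD+c_{3,0}D^3$ is the transport by $\exp(\frac t2D^2)$, together with the Heat boundary identities $v^{(2)}+2F'v^{(1)}=0$ and $v^{(4)}+4F'v^{(3)}+4(F')^2v^{(2)}+4F''v^{(1)}=0$. *)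

theory Defs
  imports "HOL-Analysis.Analysis"
begin

text \<open>\<open>C\<^sup>k\<close> via iterated directional derivatives; only meant for open \<open>S\<close>, since
  \<^const>\<open>frechet_derivative\<close> is taken at interior points.\<close>

primrec Ck_on :: "nat \<Rightarrow> 'a::real_normed_vector set \<Rightarrow> ('a \<Rightarrow> real) \<Rightarrow> bool" where
  "Ck_on 0 S g \<longleftrightarrow> continuous_on S g"
| "Ck_on (Suc k) S g \<longleftrightarrow>
     (\<forall>x\<in>S. g differentiable (at x)) \<and> (\<forall>h. Ck_on k S (\<lambda>x. frechet_derivative g (at x) h))"

definition smooth_on :: "'a::real_normed_vector set \<Rightarrow> ('a \<Rightarrow> real) \<Rightarrow> bool" where
  "smooth_on S g \<longleftrightarrow> (\<forall>k. Ck_on k S g)"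

definition dt :: "(real \<Rightarrow> real \<Rightarrow> real) \<Rightarrow> real \<Rightarrow> real \<Rightarrow> real" where
  "dt f t s = deriv (\<lambda>\<tau>. f \<tau> s) t"

definition ds :: "(real \<Rightarrow> real \<Rightarrow> real) \<Rightarrow> real \<Rightarrow> real \<Rightarrow> real" where
  "ds f t s = deriv (\<lambda>\<sigma>. f t \<sigma>) s"

text \<open>The transport \<open>N\<^sub>3 = P\<^sub>t\<^sub>,\<^sub>s L\<^sub>3 P\<^sub>t\<^sub>,\<^sub>s\<^sup>-\<^sup>1\<close> acting on functions of \<open>x\<close>: it arises from
  \<open>L\<^sub>3 = c30 D\<^sup>3 + c00 + c01 x\<close> by replacing \<open>x\<close> with \<open>x + t D - s D\<^sup>2\<close>.\<close>

definition N3 :: "real \<Rightarrow> real \<Rightarrow> real \<Rightarrow> real \<Rightarrow> real \<Rightarrow> (real \<Rightarrow> real) \<Rightarrow> real \<Rightarrow> real" where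
  "N3 c30 c00 c01 t s u x =
     (c00 + c01 * x) * u x + c01 * t * deriv u x - c01 * s * (deriv ^^ 2) u x
       + c30 * (deriv ^^ 3) u x"

lemma N3_0_0_eq_L3:
  "N3 c30 c00 c01 0 0 u x = c30 * (deriv ^^ 3) u x + c00 * u x + c01 * x * u x"
  by (simp add: N3_def algebra_simps)

definition heat_airy_rel1 ::
    "real \<Rightarrow> real \<Rightarrow> (real \<Rightarrow> real \<Rightarrow> real) \<Rightarrow> real \<Rightarrow> real \<Rightarrow> bool" where
  "heat_airy_rel1 c30 c01 f t s \<longleftrightarrow>
     3 * c30 * ds f t s + 2 * c01 * s * dt f t s + c01 * t = 0"

definition heat_airy_rel2 ::
    "real \<Rightarrow> real \<Rightarrow> real \<Rightarrow> (real \<Rightarrow> real \<Rightarrow> real) \<Rightarrow> real \<Rightarrow> real \<Rightarrow> bool" where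
  "heat_airy_rel2 c30 c00 c01 f t s \<longleftrightarrow>
     c00 + c01 * f t s - 2 * c01 * t * dt f t s - 3 * c01 * s * ds f t s
       - 4 * c30 * dt (dt f) t s + 8 * c30 * (dt f t s) ^ 3
       - 12 * c30 * dt f t s * ds f t s = 0"

definition heat_eq :: "real \<Rightarrow> real \<Rightarrow> real \<Rightarrow> (real \<Rightarrow> real) \<Rightarrow> real \<Rightarrow> bool" where
  "heat_eq c30 c00 c01 F t \<longleftrightarrow>
     c00 + c01 * F t + 2 * c01 * t * deriv F t + 8 * c30 * (deriv F t) ^ 3
       - 4 * c30 * (deriv ^^ 2) F t = 0"

text \<open>The columns act on the boundary jet \<open>(v\<^sub>x\<^sub>x\<^sub>x\<^sub>x, v\<^sub>x\<^sub>x\<^sub>x, v\<^sub>x\<^sub>x, v\<^sub>x)\<close> at \<open>x = F t\<close>. The rows are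
  \<open>N\<^sub>3 v = 0\<close> (at \<open>s = 0\<close>), the two boundary identities got by differentiating
  \<open>v t (F t) = 0\<close> once and twice in \<open>t\<close>, and \<open>D (N\<^sub>3 v) = 0\<close>.\<close>

definition M3H :: "real \<Rightarrow> real \<Rightarrow> real \<Rightarrow> (real \<Rightarrow> real) \<Rightarrow> real \<Rightarrow> real^4^4" where
  "M3H c30 c00 c01 F t = vector
     [vector [0,   c30,           0,                    c01 * t],
      vector [0,   0,             1,                    2 * deriv F t],
      vector [1,   4 * deriv F t, 4 * (deriv F t) ^ 2,  4 * (deriv ^^ 2) F t],
      vector [c30, 0,             c01 * t,              c00 + c01 * F t]]"

end

theory Submission
  imports Defs
begin

text \<open>Differentiating \<open>v t s (f t s) = 0\<close> along the boundary in \<open>t\<close> and \<open>s\<close>, and using the heat and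
  Airy equations to trade \<open>t\<close>- and \<open>s\<close>-derivatives for \<open>x\<close>-derivatives, expresses the jet
  \<open>v\<^sub>x\<^sub>x, v\<^sub>x\<^sub>x\<^sub>x, v\<^sub>x\<^sub>x\<^sub>x\<^sub>x\<close> on the boundary as multiples of \<open>v\<^sub>x\<close>. Substituting these into \<open>N\<^sub>3 v = 0\<close>
  and \<open>D (N\<^sub>3 v) = 0\<close> and cancelling \<open>v\<^sub>x\<close> gives the two relations. The rest is algebra on the slice
  \<open>s = 0\<close>, where \<open>det M\<^sub>3\<^sup>H\<close> is \<open>c30\<close> times the left-hand side of the heat equation.\<close>

section \<open>Directional derivatives of smooth functions and the chain rule along curves\<close>

text \<open>The direction comes first so that \<open>dir_deriv h\<close> is an operator on
  functions: it can be iterated with \<open>^^\<close>, and it is what the successor clause of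
  \<open>Ck_on\<close> applies to \<open>g\<close>.\<close>

definition dir_deriv :: "'a::real_normed_vector \<Rightarrow> ('a \<Rightarrow> real) \<Rightarrow> 'a \<Rightarrow> real" where
  "dir_deriv h g p = frechet_derivative g (at p) h"

lemma smooth_on_differentiable: "smooth_on S g \<Longrightarrow> p \<in> S \<Longrightarrow> g differentiable (at p)"
  unfolding smooth_on_def by (metis Ck_on.simps(2))

lemma smooth_on_continuous: "smooth_on S g \<Longrightarrow> continuous_on S g"
  unfolding smooth_on_def by (metis Ck_on.simps(1))

lemma smooth_on_dir_deriv: "smooth_on S g \<Longrightarrow> smooth_on S (dir_deriv h g)"
  unfolding smooth_on_def dir_deriv_def by (metis Ck_on.simps(2))

lemma smooth_on_dir_deriv_funpow: "smooth_on S g \<Longrightarrow> smooth_on S ((dir_deriv h ^^ n) g)"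
  by (induction n) (auto intro: smooth_on_dir_deriv)

lemma dir_deriv_cong:
  assumes "open S" "p \<in> S" "smooth_on S g" "\<And>q. q \<in> S \<Longrightarrow> g q = g' q"
  shows "dir_deriv h g p = dir_deriv h g' p"
  unfolding dir_deriv_def
  using frechet_derivative_transform_within_open[OF smooth_on_differentiable] assms by metis

lemma dir_deriv_cmult:
  assumes "g differentiable (at p)"
  shows "dir_deriv h (\<lambda>q. c * g q) p = c * dir_deriv h g p"
proof -
  have "((\<lambda>q. c * g q) has_derivative (\<lambda>h. c * frechet_derivative g (at p) h)) (at p)"
    using assms by (intro has_derivative_mult_right) (simp add: frechet_derivative_works[symmetric])
  from frechet_derivative_at[OF this] show ?thesis
    unfolding dir_deriv_def by metis
qed

text \<open>One chain rule serves both the partial derivatives in \<open>t\<close>,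
  \<open>s\<close>, \<open>x\<close> (curves along the axes) and the derivatives along the moving
  boundary.\<close>

lemma has_real_derivative_along_curve:
  assumes "g differentiable (at (\<gamma> a))" "(\<gamma> has_vector_derivative h) (at a)"
  shows "((\<lambda>a. g (\<gamma> a)) has_real_derivative dir_deriv h g (\<gamma> a)) (at a)"
proof -
  let ?D = "frechet_derivative g (at (\<gamma> a))"
  have D: "(g has_derivative ?D) (at (\<gamma> a))"
    using assms(1) by (simp add: frechet_derivative_works[symmetric])
  have "((\<lambda>a. g (\<gamma> a)) has_derivative (\<lambda>r. ?D (r *\<^sub>R h))) (at a)"
    using has_derivative_compose[OF assms(2)[unfolded has_vector_derivative_def] D] .
  moreover have "?D (r *\<^sub>R h) = r * ?D h" for r
    using linear_frechet_derivative[OF assms(1)] by (simp add: linear_scale)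
  ultimately show ?thesis
    by (simp add: has_field_derivative_def dir_deriv_def mult.commute[of _ "?D h"])
qed

lemma has_real_derivative_along_line:
  assumes "g differentiable (at (p + a *\<^sub>R h))"
  shows "((\<lambda>a. g (p + a *\<^sub>R h)) has_real_derivative dir_deriv h g (p + a *\<^sub>R h)) (at a)"
  by (rule has_real_derivative_along_curve[where \<gamma> = "\<lambda>a. p + a *\<^sub>R h", OF assms])
    (auto intro!: derivative_eq_intros)

lemma has_vector_derivative_Pair_left: "((\<lambda>a. (a, y)) has_vector_derivative (1, 0)) (at (a::real))"
  by (rule has_vector_derivative_Pair[OF has_vector_derivative_id has_vector_derivative_const])

lemma has_vector_derivative_Pair_right: "((\<lambda>b. (x, b)) has_vector_derivative (0, 1)) (at (b::real))"
  by (rule has_vector_derivative_Pair[OF has_vector_derivative_const has_vector_derivative_id])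

lemma dir_deriv_linear:
  assumes "g differentiable (at p)"
  shows "dir_deriv (h + c *\<^sub>R k) g p = dir_deriv h g p + c * dir_deriv k g p"
  using linear_frechet_derivative[OF assms] by (simp add: dir_deriv_def linear_add linear_scale)

section \<open>Symmetry of second directional derivatives\<close>

text \<open>The mean value theorem is applied twice: in direction \<open>h\<close> to the increment
  of \<open>g\<close> over \<open>e\<close> times \<open>k\<close>, then in direction
  \<open>k\<close> to \<open>dir_deriv h g\<close>.\<close>

lemma second_difference_eq_dir_deriv:
  assumes g: "\<And>q. q \<in> S \<Longrightarrow> g differentiable (at q)"
    and Dg: "\<And>q. q \<in> S \<Longrightarrow> dir_deriv h g differentiable (at q)"
    and e: "0 < e"
    and S: "\<And>a b. 0 \<le> a \<Longrightarrow> a \<le> e \<Longrightarrow> 0 \<le> b \<Longrightarrow> b \<le> e \<Longrightarrow> p + a *\<^sub>R h + b *\<^sub>R k \<in> S"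
  obtains a b where "0 < a" "a < e" "0 < b" "b < e"
    "g (p + e *\<^sub>R h + e *\<^sub>R k) - g (p + e *\<^sub>R h) - g (p + e *\<^sub>R k) + g p
       = e * e * dir_deriv k (dir_deriv h g) (p + a *\<^sub>R h + b *\<^sub>R k)"
proof -
  let ?\<phi> = "\<lambda>a. g (p + e *\<^sub>R k + a *\<^sub>R h) - g (p + a *\<^sub>R h)"
  have "\<exists>a>0. a < e \<and> ?\<phi> e - ?\<phi> 0 =
      (e - 0) * (dir_deriv h g (p + e *\<^sub>R k + a *\<^sub>R h) - dir_deriv h g (p + a *\<^sub>R h))"
  proof (rule MVT2[OF e])
    fix a assume a: "0 \<le> a" "a \<le> e"
    have "g differentiable (at (p + e *\<^sub>R k + a *\<^sub>R h))" "g differentiable (at (p + a *\<^sub>R h))"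
      using g[OF S[of a e]] g[OF S[of a 0]] a e by (simp_all add: algebra_simps)
    then show "(?\<phi> has_real_derivative
        dir_deriv h g (p + e *\<^sub>R k + a *\<^sub>R h) - dir_deriv h g (p + a *\<^sub>R h)) (at a)"
      by (intro DERIV_diff has_real_derivative_along_line)
  qed
  then obtain a where a: "0 < a" "a < e" and \<phi>: "?\<phi> e - ?\<phi> 0 =
      e * (dir_deriv h g (p + e *\<^sub>R k + a *\<^sub>R h) - dir_deriv h g (p + a *\<^sub>R h))"
    by auto
  let ?\<psi> = "\<lambda>b. dir_deriv h g (p + a *\<^sub>R h + b *\<^sub>R k)"
  have "\<exists>b>0. b < e \<and> ?\<psi> e - ?\<psi> 0 =
      (e - 0) * dir_deriv k (dir_deriv h g) (p + a *\<^sub>R h + b *\<^sub>R k)"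
    by (rule MVT2[OF e]) (use Dg S a in \<open>auto intro!: has_real_derivative_along_line\<close>)
  then obtain b where b: "0 < b" "b < e" and \<psi>: "?\<psi> e - ?\<psi> 0 =
      e * dir_deriv k (dir_deriv h g) (p + a *\<^sub>R h + b *\<^sub>R k)"
    by auto
  show thesis
  proof (rule that[OF a b])
    show "g (p + e *\<^sub>R h + e *\<^sub>R k) - g (p + e *\<^sub>R h) - g (p + e *\<^sub>R k) + g p
       = e * e * dir_deriv k (dir_deriv h g) (p + a *\<^sub>R h + b *\<^sub>R k)"
      using \<phi> \<psi> by (simp add: add_ac)
  qed
qed

text \<open>The second difference is symmetric in \<open>h\<close> and \<open>k\<close>, so dividing it by \<open>e\<^sup>2\<close> gives values of both
  mixed derivatives at points close to \<open>p\<close>.\<close>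

lemma dir_deriv_commute:
  assumes S: "open S" "p \<in> S" and g: "smooth_on S g"
  shows "dir_deriv k (dir_deriv h g) p = dir_deriv h (dir_deriv k g) p"
proof (rule ccontr)
  let ?A = "dir_deriv k (dir_deriv h g)" and ?B = "dir_deriv h (dir_deriv k g)"
  assume "?A p \<noteq> ?B p"
  \<comment> \<open>With half the distance, no single number can lie within \<epsilon> of both
    \<open>?A p\<close> and \<open>?B p\<close>.\<close>
  define \<epsilon> where "\<epsilon> = dist (?A p) (?B p) / 2"
  have \<epsilon>: "\<epsilon> > 0" using \<open>?A p \<noteq> ?B p\<close> by (simp add: \<epsilon>_def)
  have "isCont ?A p" "isCont ?B p"
    using S smooth_on_continuous[OF smooth_on_dir_deriv[OF smooth_on_dir_deriv[OF g]]]
    by (auto simp: continuous_on_eq_continuous_at)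
  then have "\<forall>\<^sub>F q in nhds p. dist (?A q) (?A p) < \<epsilon> \<and> dist (?B q) (?B p) < \<epsilon> \<and> q \<in> S"
    using \<epsilon> S by (intro eventually_conj)
      (auto simp: isCont_def tendsto_at_iff_tendsto_nhds eventually_nhds_in_open
        intro: tendstoD)
  then obtain d where d: "d > 0"
    and near: "\<And>q. dist q p < d \<Longrightarrow> dist (?A q) (?A p) < \<epsilon> \<and> dist (?B q) (?B p) < \<epsilon> \<and> q \<in> S"
    unfolding eventually_nhds_metric by blast
  \<comment> \<open>The summand 1 keeps \<open>N\<close> positive when \<open>h\<close> and
    \<open>k\<close> both vanish; \<open>e\<close> is then small enough for the whole parallelogram
    spanned by \<open>e\<close> times \<open>h\<close> and \<open>k\<close> to stay in the
    \<open>d\<close>-ball around \<open>p\<close>.\<close>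
  define N where "N = norm h + norm k + 1"
  have N: "N > 0" by (simp add: N_def add_nonneg_pos)
  define e where "e = d / (2 * N)"
  have e: "e > 0" using d N by (simp add: e_def)
  have "e * N = d / 2" using N by (simp add: e_def)
  then have e_small: "e * (norm h + norm k) < d"
    using d e by (simp add: N_def distrib_left)
  have close: "dist (p + a *\<^sub>R h + b *\<^sub>R k) p < d"
    if "0 \<le> a" "a \<le> e" "0 \<le> b" "b \<le> e" for a b
  proof -
    have "norm (a *\<^sub>R h + b *\<^sub>R k) \<le> a * norm h + b * norm k"
      using norm_triangle_ineq[of "a *\<^sub>R h" "b *\<^sub>R k"] that by simp
    also have "\<dots> \<le> e * norm h + e * norm k"
      using that by (intro add_mono mult_right_mono) auto
    finally show ?thesis
      using e_small by (simp add: dist_norm algebra_simps)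
  qed
  obtain a b where ab: "0 < a" "a < e" "0 < b" "b < e"
    "g (p + e *\<^sub>R h + e *\<^sub>R k) - g (p + e *\<^sub>R h) - g (p + e *\<^sub>R k) + g p
       = e * e * ?A (p + a *\<^sub>R h + b *\<^sub>R k)"
    by (rule second_difference_eq_dir_deriv[of S g h e p k])
      (use smooth_on_differentiable g smooth_on_dir_deriv e near close in \<open>blast+\<close>)
  have near': "p + a *\<^sub>R k + b *\<^sub>R h \<in> S" if "0 \<le> a" "a \<le> e" "0 \<le> b" "b \<le> e" for a b
    using near[OF close, of b a] that by (simp add: add_ac)
  obtain a' b' where ab': "0 < a'" "a' < e" "0 < b'" "b' < e"
    "g (p + e *\<^sub>R k + e *\<^sub>R h) - g (p + e *\<^sub>R k) - g (p + e *\<^sub>R h) + g p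
       = e * e * ?B (p + a' *\<^sub>R k + b' *\<^sub>R h)"
    by (rule second_difference_eq_dir_deriv[of S g k e p h])
      (use smooth_on_differentiable g smooth_on_dir_deriv e near' in \<open>blast+\<close>)
  \<comment> \<open>Exchanging \<open>h\<close> and \<open>k\<close> only reorders the terms of the
    second difference, so the two mean value expressions are equal.\<close>
  have "e * e * ?A (p + a *\<^sub>R h + b *\<^sub>R k) = e * e * ?B (p + b' *\<^sub>R h + a' *\<^sub>R k)"
    using ab(5) ab'(5) by (simp add: algebra_simps)
  then have "?A (p + a *\<^sub>R h + b *\<^sub>R k) = ?B (p + b' *\<^sub>R h + a' *\<^sub>R k)"
    using e by simp
  moreover have "dist (?A (p + a *\<^sub>R h + b *\<^sub>R k)) (?A p) < \<epsilon>"
      "dist (?B (p + b' *\<^sub>R h + a' *\<^sub>R k)) (?B p) < \<epsilon>"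
    using near[OF close] ab ab' by simp_all
  ultimately have "dist (?A p) (?B p) < dist (?A p) (?B p)"
    unfolding \<epsilon>_def by (metis dist_triangle_half_r)
  then show False by simp
qed

section \<open>Derivatives of the boundary function and of smooth functions restricted to the
  boundary\<close>

lemma open_slice_fst: "open I \<Longrightarrow> open {\<tau>. (\<tau>, s) \<in> I}"
  using open_vimage[of I "\<lambda>\<tau>. (\<tau>, s)"] by (simp add: vimage_def continuous_intros)

lemma open_slice_snd: "open I \<Longrightarrow> open {\<sigma>. (t, \<sigma>) \<in> I}"
  using open_vimage[of I "\<lambda>\<sigma>. (t, \<sigma>)"] by (simp add: vimage_def continuous_intros)

context
  fixes I :: "(real \<times> real) set" and f :: "real \<Rightarrow> real \<Rightarrow> real"
  assumes open_I: "open I" and smooth_f: "smooth_on I (\<lambda>(t, s). f t s)"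
begin

lemma has_derivative_dt_dir_deriv:
  assumes "(t, s) \<in> I"
  shows "((\<lambda>\<tau>. f \<tau> s) has_real_derivative dir_deriv (1, 0) (\<lambda>(t, s). f t s) (t, s)) (at t)"
  using has_real_derivative_along_curve[OF _ has_vector_derivative_Pair_left,
      OF smooth_on_differentiable[OF smooth_f assms]]
  by simp

lemma dt_eq_dir_deriv:
  "(t, s) \<in> I \<Longrightarrow> dt f t s = dir_deriv (1, 0) (\<lambda>(t, s). f t s) (t, s)"
  unfolding dt_def by (rule DERIV_imp_deriv[OF has_derivative_dt_dir_deriv])

lemma has_derivative_dt:
  "(t, s) \<in> I \<Longrightarrow> ((\<lambda>\<tau>. f \<tau> s) has_real_derivative dt f t s) (at t)"
  using has_derivative_dt_dir_deriv dt_eq_dir_deriv by simp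

lemma has_derivative_ds:
  assumes "(t, s) \<in> I"
  shows "((\<lambda>\<sigma>. f t \<sigma>) has_real_derivative ds f t s) (at s)"
proof -
  have "((\<lambda>\<sigma>. f t \<sigma>) has_real_derivative dir_deriv (0, 1) (\<lambda>(t, s). f t s) (t, s)) (at s)"
    using has_real_derivative_along_curve[OF _ has_vector_derivative_Pair_right,
        OF smooth_on_differentiable[OF smooth_f assms]]
    by simp
  then show ?thesis
    unfolding ds_def by (metis DERIV_imp_deriv)
qed

lemma has_derivative_dt_dt:
  assumes "(t, s) \<in> I"
  shows "((\<lambda>\<tau>. dt f \<tau> s) has_real_derivative dt (dt f) t s) (at t)"
proof -
  let ?g = "dir_deriv (1, 0) (\<lambda>(t, s). f t s)"
  have "((\<lambda>\<tau>. ?g (\<tau>, s)) has_real_derivative dir_deriv (1, 0) ?g (t, s)) (at t)"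
    by (rule has_real_derivative_along_curve[OF _ has_vector_derivative_Pair_left,
        OF smooth_on_differentiable[OF smooth_on_dir_deriv[OF smooth_f] assms]])
  \<comment> \<open>\<open>dt f\<close> is known to agree with \<open>?g\<close> only on
    \<open>I\<close>, so the derivative is transferred on the open slice through
    \<open>(t, s)\<close>.\<close>
  then have "((\<lambda>\<tau>. dt f \<tau> s) has_real_derivative dir_deriv (1, 0) ?g (t, s)) (at t)"
    by (rule has_field_derivative_transform_within_open[OF _ open_slice_fst[OF open_I, of s]])
      (use assms dt_eq_dir_deriv in auto)
  then show ?thesis
    unfolding dt_def[of "dt f"] by (metis DERIV_imp_deriv)
qed

text \<open>The point \<open>((\<tau>, s), f \<tau> s)\<close> moves with velocity
  \<open>((1, 0), 0)\<close> plus \<open>dt f t s\<close> times the unit vector in \<open>x\<close>;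
  linearity of the derivative in the direction separates the two contributions.\<close>

lemma has_derivative_boundary_dt:
  assumes W: "smooth_on (I \<times> UNIV) W" and ts: "(t, s) \<in> I"
  shows "((\<lambda>\<tau>. W ((\<tau>, s), f \<tau> s)) has_real_derivative
    dir_deriv ((1, 0), 0) W ((t, s), f t s) + dt f t s * dir_deriv (0, 1) W ((t, s), f t s)) (at t)"
proof -
  have d: "W differentiable (at ((t, s), f t s))"
    using smooth_on_differentiable[OF W] ts by simp
  have "((\<lambda>\<tau>. ((\<tau>, s), f \<tau> s)) has_vector_derivative ((1, 0), 0) + dt f t s *\<^sub>R (0, 1)) (at t)"
    using has_derivative_dt[OF ts]
    by (auto simp: has_real_derivative_iff_has_vector_derivative intro!: derivative_eq_intros)
  from has_real_derivative_along_curve[OF d this] show ?thesis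
    by (simp only: dir_deriv_linear[OF d])
qed

lemma has_derivative_boundary_ds:
  assumes W: "smooth_on (I \<times> UNIV) W" and ts: "(t, s) \<in> I"
  shows "((\<lambda>\<sigma>. W ((t, \<sigma>), f t \<sigma>)) has_real_derivative
    dir_deriv ((0, 1), 0) W ((t, s), f t s) + ds f t s * dir_deriv (0, 1) W ((t, s), f t s)) (at s)"
proof -
  have d: "W differentiable (at ((t, s), f t s))"
    using smooth_on_differentiable[OF W] ts by simp
  have "((\<lambda>\<sigma>. ((t, \<sigma>), f t \<sigma>)) has_vector_derivative ((0, 1), 0) + ds f t s *\<^sub>R (0, 1)) (at s)"
    using has_derivative_ds[OF ts]
    by (auto simp: has_real_derivative_iff_has_vector_derivative intro!: derivative_eq_intros)
  from has_real_derivative_along_curve[OF d this] show ?thesis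
    by (simp only: dir_deriv_linear[OF d])
qed

end

section \<open>Boundary jet identities and the two Heat-Airy relations\<close>

lemma heat_airy_relations:
  assumes open_I: "open I"
    and smooth_f: "smooth_on I (\<lambda>(t, s). f t s)"
    and smooth_v: "smooth_on (I \<times> UNIV) (\<lambda>((t, s), x). v t s x)"
    and heat: "\<And>t s x. (t, s) \<in> I \<Longrightarrow>
                 deriv (\<lambda>\<tau>. v \<tau> s x) t = 1/2 * (deriv ^^ 2) (v t s) x"
    and airy: "\<And>t s x. (t, s) \<in> I \<Longrightarrow>
                 deriv (\<lambda>\<sigma>. v t \<sigma> x) s = - (1/3) * (deriv ^^ 3) (v t s) x"
    and N3_v: "\<And>t s x. (t, s) \<in> I \<Longrightarrow> N3 c30 c00 c01 t s (v t s) x = 0"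
    and boundary: "\<And>t s. (t, s) \<in> I \<Longrightarrow> v t s (f t s) = 0"
    and nondegenerate: "\<And>t s. (t, s) \<in> I \<Longrightarrow> deriv (v t s) (f t s) \<noteq> 0"
    and ts: "(t, s) \<in> I"
  shows "heat_airy_rel1 c30 c01 f t s \<and> heat_airy_rel2 c30 c00 c01 f t s"
proof -
  let ?S = "I \<times> (UNIV :: real set)"
  define V where "V = (\<lambda>((t, s), x). v t s x)"
  \<comment> \<open>\<open>W n\<close> is the \<open>n\<close>-th \<open>x\<close>-derivative of
    \<open>v\<close>, kept as a function of all three variables so that it can also be
    differentiated in \<open>t\<close>, \<open>s\<close> and along the boundary.\<close>
  define W where "W n = (dir_deriv (0, 1) ^^ n) V" for n
  have S: "open ?S"
    using open_I by (simp add: open_Times)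
  have W: "smooth_on ?S (W n)" for n
    unfolding W_def V_def using smooth_v by (rule smooth_on_dir_deriv_funpow)
  have W_Suc: "dir_deriv (0, 1) (W n) = W (Suc n)" for n
    by (simp add: W_def)
  have W_diff: "W n differentiable (at ((t, s), x))" if "(t, s) \<in> I" for n t s x
    using smooth_on_differentiable[OF W] that by simp
  have W_x: "((\<lambda>x. W n ((t, s), x)) has_real_derivative W (Suc n) ((t, s), x)) (at x)"
    if "(t, s) \<in> I" for n t s x
    using has_real_derivative_along_curve[OF _ has_vector_derivative_Pair_right, OF W_diff[OF that]]
    by (simp add: W_Suc)
  have deriv_v: "(deriv ^^ n) (v t s) = (\<lambda>x. W n ((t, s), x))" if "(t, s) \<in> I" for n t s
  proof (induction n)
    case 0
    show ?case by (simp add: W_def V_def)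
  next
    case (Suc n)
    then show ?case
      using DERIV_imp_deriv[OF W_x[OF that]] by auto
  qed
  have heat0: "dir_deriv ((1, 0), 0) (W 0) q = 1/2 * W 2 q" if "q \<in> ?S" for q
  proof -
    obtain t s x where q: "q = ((t, s), x)" by (metis surj_pair)
    with that have ts: "(t, s) \<in> I" by simp
    have "((\<lambda>\<tau>. W 0 ((\<tau>, s), x)) has_real_derivative dir_deriv ((1, 0), 0) (W 0) q) (at t)"
      unfolding q
      by (rule has_real_derivative_along_curve[OF _ has_vector_derivative_Pair[OF
          has_vector_derivative_Pair_left has_vector_derivative_const], OF W_diff[OF ts]])
    then have "deriv (\<lambda>\<tau>. v \<tau> s x) t = dir_deriv ((1, 0), 0) (W 0) q"
      by (simp add: W_def V_def DERIV_imp_deriv)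
    then show ?thesis
      using heat[OF ts, of x] deriv_v[OF ts, of 2] by (simp add: q)
  qed
  have airy0: "dir_deriv ((0, 1), 0) (W 0) ((t, s), x) = - (1/3) * W 3 ((t, s), x)" for x
  proof -
    have "((\<lambda>\<sigma>. W 0 ((t, \<sigma>), x)) has_real_derivative dir_deriv ((0, 1), 0) (W 0) ((t, s), x)) (at s)"
      by (rule has_real_derivative_along_curve[OF _ has_vector_derivative_Pair[OF
          has_vector_derivative_Pair_right has_vector_derivative_const], OF W_diff[OF ts]])
    then have "deriv (\<lambda>\<sigma>. v t \<sigma> x) s = dir_deriv ((0, 1), 0) (W 0) ((t, s), x)"
      by (simp add: W_def V_def DERIV_imp_deriv)
    then show ?thesis
      using airy[OF ts, of x] deriv_v[OF ts, of 3] by simp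
  qed
  \<comment> \<open>Every \<open>x\<close>-derivative of a heat solution solves the heat equation
    again, because the derivatives in \<open>x\<close> and \<open>t\<close> commute.\<close>
  have heat_n: "q \<in> ?S \<Longrightarrow> dir_deriv ((1, 0), 0) (W n) q = 1/2 * W (n + 2) q" for n q
  proof (induction n arbitrary: q)
    case 0
    then show ?case using heat0 by (simp add: numeral_2_eq_2)
  next
    case (Suc n)
    have "dir_deriv ((1, 0), 0) (W (Suc n)) q = dir_deriv (0, 1) (dir_deriv ((1, 0), 0) (W n)) q"
      unfolding W_Suc[symmetric] by (rule dir_deriv_commute[OF S Suc.prems W])
    also have "\<dots> = dir_deriv (0, 1) (\<lambda>q. 1/2 * W (n + 2) q) q"
      by (rule dir_deriv_cong[OF S Suc.prems smooth_on_dir_deriv[OF W] Suc.IH])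
    also have "\<dots> = 1/2 * W (Suc n + 2) q"
      unfolding dir_deriv_cmult[OF smooth_on_differentiable[OF W Suc.prems]] by (simp add: W_Suc)
    finally show ?case .
  qed
  define w where "w n = W n ((t, s), f t s)" for n
  have along_t: "((\<lambda>\<tau>. W n ((\<tau>, s), f \<tau> s)) has_real_derivative
      1/2 * W (n + 2) ((t, s), f t s) + dt f t s * W (Suc n) ((t, s), f t s)) (at t)"
    if "(t, s) \<in> I" for n t
    using has_derivative_boundary_dt[OF open_I smooth_f W that] that
    by (simp only: W_Suc heat_n mem_Sigma_iff UNIV_I)
  have w0: "W 0 ((t, s), f t s) = 0" if "(t, s) \<in> I" for t s
    using boundary[OF that] by (simp add: W_def V_def)
  \<comment> \<open>The derivative in \<open>t\<close> of \<open>v = 0\<close> along the boundary.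
    The time is left free here because this identity is itself differentiated in \<open>t\<close> to
    obtain \<open>w4\<close>.\<close>
  have w2: "W 2 ((t, s), f t s) = - 2 * dt f t s * W 1 ((t, s), f t s)" if "(t, s) \<in> I" for t
  proof -
    have "((\<lambda>\<tau>. W 0 ((\<tau>, s), f \<tau> s)) has_real_derivative 0) (at t)"
      by (rule has_field_derivative_transform_within_open[OF DERIV_const[of 0] open_slice_fst[OF open_I, of s]])
        (use that w0 in auto)
    from DERIV_unique[OF along_t[OF that] this] show ?thesis
      by (simp add: numeral_2_eq_2)
  qed
  \<comment> \<open>The derivative in \<open>s\<close> of \<open>v = 0\<close> along the boundary,
    with \<open>airy0\<close> replacing the \<open>s\<close>-derivative.\<close>
  have w3: "w 3 = 3 * ds f t s * w 1"
  proof -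
    have "((\<lambda>\<sigma>. W 0 ((t, \<sigma>), f t \<sigma>)) has_real_derivative 0) (at s)"
      by (rule has_field_derivative_transform_within_open[OF DERIV_const[of 0] open_slice_snd[OF open_I, of t]])
        (use ts w0 in auto)
    from DERIV_unique[OF has_derivative_boundary_ds[OF open_I smooth_f W ts] this] show ?thesis
      by (simp add: airy0 W_Suc w_def)
  qed
  have w4: "w 4 = (- 4 * dt (dt f) t s + 8 * dt f t s ^ 3 - 12 * dt f t s * ds f t s) * w 1"
  proof -
    \<comment> \<open>The two sides of \<open>w2\<close> are differentiated along the boundary: the
      right side by the product rule, the left side by \<open>along_t\<close>, which brings in
      \<open>w 4\<close>. Comparing them and inserting \<open>w2\<close> and \<open>w3\<close>
      solves for \<open>w 4\<close>.\<close>
    have "((\<lambda>\<tau>. - 2 * dt f \<tau> s * W 1 ((\<tau>, s), f \<tau> s)) has_real_derivative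
        (- 2 * dt (dt f) t s) * w 1 + (1/2 * w 3 + dt f t s * w 2) * (- 2 * dt f t s)) (at t)"
      using DERIV_mult[OF DERIV_cmult[OF has_derivative_dt_dt[OF open_I smooth_f ts], of "- 2"]
          along_t[OF ts, of 1]]
      by (simp add: w_def numeral_2_eq_2 numeral_3_eq_3)
    then have "((\<lambda>\<tau>. W 2 ((\<tau>, s), f \<tau> s)) has_real_derivative
        (- 2 * dt (dt f) t s) * w 1 + (1/2 * w 3 + dt f t s * w 2) * (- 2 * dt f t s)) (at t)"
      by (rule has_field_derivative_transform_within_open[OF _ open_slice_fst[OF open_I, of s]])
        (use ts w2 in auto)
    from DERIV_unique[OF along_t[OF ts] this]
    have "1/2 * w 4 + dt f t s * w 3
        = (- 2 * dt (dt f) t s) * w 1 + (1/2 * w 3 + dt f t s * w 2) * (- 2 * dt f t s)"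
      by (simp add: w_def)
    moreover have "w 2 = - 2 * dt f t s * w 1"
      using w2[OF ts] by (simp add: w_def)
    ultimately show ?thesis
      using w3 by (simp add: algebra_simps power3_eq_cube)
  qed
  have N3_W: "(c00 + c01 * x) * W 0 ((t, s), x) + c01 * t * W 1 ((t, s), x)
      - c01 * s * W 2 ((t, s), x) + c30 * W 3 ((t, s), x) = 0" for x
    using N3_v[OF ts, of x] deriv_v[OF ts, of 0] deriv_v[OF ts, of 1]
      deriv_v[OF ts, of 2] deriv_v[OF ts, of 3]
    by (simp add: N3_def)
  \<comment> \<open>This is \<open>D (N3 v)\<close> on the boundary; it vanishes since
    \<open>N3_W\<close> holds for all \<open>x\<close>. The term \<open>c01 * w 0\<close> comes from
    differentiating the coefficient \<open>c00 + c01 * x\<close>.\<close>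
  have "((\<lambda>x. (c00 + c01 * x) * W 0 ((t, s), x) + c01 * t * W 1 ((t, s), x)
      - c01 * s * W 2 ((t, s), x) + c30 * W 3 ((t, s), x)) has_real_derivative
      c01 * w 0 + (c00 + c01 * f t s) * w 1 + c01 * t * w 2 - c01 * s * w 3 + c30 * w 4) (at (f t s))"
    unfolding w_def
    by (auto intro!: derivative_eq_intros W_x[OF ts] simp: numeral_eq_Suc)
  then have "c01 * w 0 + (c00 + c01 * f t s) * w 1 + c01 * t * w 2 - c01 * s * w 3 + c30 * w 4 = 0"
    unfolding N3_W using DERIV_unique[OF _ DERIV_const] by blast
  moreover have "c01 * t * w 1 - c01 * s * w 2 + c30 * w 3 = 0"
    using N3_W[of "f t s"] w0[OF ts] by (simp add: w_def)
  moreover have "w 0 = 0" "w 2 = - 2 * dt f t s * w 1"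
    using w0[OF ts] w2[OF ts] by (simp_all add: w_def)
  ultimately have
    "w 1 * (3 * c30 * ds f t s + 2 * c01 * s * dt f t s + c01 * t) = 0"
    "w 1 * (c00 + c01 * f t s - 2 * c01 * t * dt f t s - 3 * c01 * s * ds f t s
       - 4 * c30 * dt (dt f) t s + 8 * c30 * (dt f t s) ^ 3 - 12 * c30 * dt f t s * ds f t s) = 0"
    unfolding w3 w4 by (simp_all add: algebra_simps)
  moreover have "w 1 \<noteq> 0"
    using nondegenerate[OF ts] deriv_v[OF ts, of 1] by (simp add: w_def)
  ultimately show ?thesis
    by (simp add: heat_airy_rel1_def heat_airy_rel2_def)
qed

section \<open>The determinant of \<open>M3H\<close> and the algebra on the slice
  \<open>s = 0\<close>\<close>

lemma vector_4:
  "(vector [x, y, z, w] :: 'a::zero^4) $ 1 = x"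
  "(vector [x, y, z, w] :: 'a::zero^4) $ 2 = y"
  "(vector [x, y, z, w] :: 'a::zero^4) $ 3 = z"
  "(vector [x, y, z, w] :: 'a::zero^4) $ 4 = w"
  unfolding vector_def by simp_all

lemma det_M3H:
  "det (M3H c30 c00 c01 F t) = c30 * (c00 + c01 * F t + 2 * c01 * t * deriv F t
     + 8 * c30 * (deriv F t) ^ 3 - 4 * c30 * (deriv ^^ 2) F t)"
proof -
  \<comment> \<open>Side conditions for splitting the Leibniz sum over permutations of the four
    indices one index at a time.\<close>
  have f: "finite {2::4, 3, 4}" "1 \<notin> {2::4, 3, 4}" "finite {3::4, 4}" "2 \<notin> {3::4, 4}"
      "finite {4::4}" "3 \<notin> {4::4}"
    by auto
  show ?thesis
    unfolding det_def UNIV_4 sum_over_permutations_insert[OF f(1,2)]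
      sum_over_permutations_insert[OF f(3,4)] sum_over_permutations_insert[OF f(5,6)]
      permutes_sing
    by (simp add: M3H_def vector_4 swap_id_eq)
      (simp add: sign_swap_id permutation_swap_id permutation_compose sign_compose
        sign_id swap_id_eq algebra_simps power2_eq_square power3_eq_cube)
qed

lemma heat_eq_iff_det_M3H:
  "c30 \<noteq> 0 \<Longrightarrow> heat_eq c30 c00 c01 F t \<longleftrightarrow> det (M3H c30 c00 c01 F t) = 0"
  by (simp add: heat_eq_def det_M3H)

lemma heat_airy_rel1_slice:
  "c30 \<noteq> 0 \<Longrightarrow> heat_airy_rel1 c30 c01 g t 0 \<longleftrightarrow> ds g t 0 = - (c01 / (3 * c30)) * t"
  by (auto simp: heat_airy_rel1_def field_simps)

text \<open>The given value of \<open>ds g t 0\<close> turns the mixed term into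
  \<open>+ 4 * c01 * t * dt g t 0\<close>, which changes the coefficient \<open>- 2\<close> of
  \<open>c01 * t * dt g t 0\<close> into the \<open>+ 2\<close> of the heat equation.\<close>

lemma heat_airy_rel2_slice:
  assumes "c30 \<noteq> 0" "ds g t 0 = - (c01 / (3 * c30)) * t"
  shows "heat_airy_rel2 c30 c00 c01 g t 0 \<longleftrightarrow> heat_eq c30 c00 c01 (\<lambda>\<tau>. g \<tau> 0) t"
proof -
  have ds: "12 * c30 * dt g t 0 * ds g t 0 = - 4 * c01 * t * dt g t 0"
    unfolding assms(2) using assms(1) by (simp add: field_simps)
  have dt: "(deriv ^^ 2) (\<lambda>\<tau>. g \<tau> 0) t = dt (dt g) t 0" "deriv (\<lambda>\<tau>. g \<tau> 0) t = dt g t 0"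
    by (simp_all add: dt_def numeral_2_eq_2)
  show ?thesis
    unfolding heat_airy_rel2_def heat_eq_def ds dt by auto
qed
text \<open>\<open>F\<close> is tied to \<open>f\<close> only where \<open>(t, 0)\<close> lies in
  \<open>I\<close>. Agreement on an open set is enough, as the equation involves only the germ of
  \<open>F\<close> at \<open>t\<close>.\<close>

lemma heat_eq_cong:
  assumes "open U" "t \<in> U" "\<And>\<tau>. \<tau> \<in> U \<Longrightarrow> F \<tau> = G \<tau>"
  shows "heat_eq c30 c00 c01 F t \<longleftrightarrow> heat_eq c30 c00 c01 G t"
proof -
  \<comment> \<open>Equality of the first derivatives on all of \<open>U\<close>, not just at
    \<open>t\<close>, permits a second differentiation.\<close>
  have d: "deriv F \<tau> = deriv G \<tau>" if "\<tau> \<in> U" for \<tau>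
    using assms that by (intro deriv_cong_ev) (auto simp: eventually_nhds)
  then have "deriv (deriv F) t = deriv (deriv G) t"
    using assms by (intro deriv_cong_ev) (auto simp: eventually_nhds)
  then show ?thesis
    using assms d by (simp add: heat_eq_def numeral_2_eq_2)
qed

theorem proposition7p3:
  fixes c30 c00 c01 :: real
    and I :: "(real \<times> real) set"
    and f :: "real \<Rightarrow> real \<Rightarrow> real"
    and v :: "real \<Rightarrow> real \<Rightarrow> real \<Rightarrow> real"
    and F :: "real \<Rightarrow> real"
  assumes c30: "c30 \<noteq> 0"
    and c01: "c01 \<noteq> 0"
    and open_I: "open I"
    and smooth_f: "smooth_on I (\<lambda>(t, s). f t s)"
    and smooth_v: "smooth_on (I \<times> UNIV) (\<lambda>((t, s), x). v t s x)"
    and heat: "\<And>t s x. (t, s) \<in> I \<Longrightarrow>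
                 deriv (\<lambda>\<tau>. v \<tau> s x) t = 1/2 * (deriv ^^ 2) (v t s) x"
    and airy: "\<And>t s x. (t, s) \<in> I \<Longrightarrow>
                 deriv (\<lambda>\<sigma>. v t \<sigma> x) s = - (1/3) * (deriv ^^ 3) (v t s) x"
    and N3_v: "\<And>t s x. (t, s) \<in> I \<Longrightarrow> N3 c30 c00 c01 t s (v t s) x = 0"
    and boundary: "\<And>t s. (t, s) \<in> I \<Longrightarrow> v t s (f t s) = 0"
    and nondegenerate: "\<And>t s. (t, s) \<in> I \<Longrightarrow> deriv (v t s) (f t s) \<noteq> 0"
    and F: "\<And>t. (t, 0) \<in> I \<Longrightarrow> F t = f t 0"
  shows
    \<comment> \<open>the two spatial-jet relations hold for the given boundary\<close>
    "(\<forall>(t, s)\<in>I. heat_airy_rel1 c30 c01 f t s \<and> heat_airy_rel2 c30 c00 c01 f t s) \<and>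
     \<comment> \<open>what they give on the slice \<open>s = 0\<close>\<close>
     (\<forall>t. (t, 0) \<in> I \<longrightarrow>
        ds f t 0 = - (c01 / (3 * c30)) * t \<and>
        heat_eq c30 c00 c01 F t \<and>
        det (M3H c30 c00 c01 F t) = 0) \<and>
     \<comment> \<open>the individual recovery steps, which use the relations alone\<close>
     (\<forall>g. smooth_on I (\<lambda>(t, s). g t s) \<longrightarrow>
       (\<forall>t. (t, 0) \<in> I \<longrightarrow>
         (heat_airy_rel1 c30 c01 g t 0 \<longrightarrow> ds g t 0 = - (c01 / (3 * c30)) * t) \<and>
         (ds g t 0 = - (c01 / (3 * c30)) * t \<longrightarrow>
            (heat_airy_rel2 c30 c00 c01 g t 0 \<longleftrightarrow> heat_eq c30 c00 c01 (\<lambda>\<tau>. g \<tau> 0) t)) \<and>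
         (heat_eq c30 c00 c01 (\<lambda>\<tau>. g \<tau> 0) t \<longleftrightarrow> det (M3H c30 c00 c01 (\<lambda>\<tau>. g \<tau> 0) t) = 0)))"
proof -
  have rels: "heat_airy_rel1 c30 c01 f t s \<and> heat_airy_rel2 c30 c00 c01 f t s"
    if "(t, s) \<in> I" for t s
    by (rule heat_airy_relations[OF open_I smooth_f smooth_v heat airy N3_v boundary nondegenerate that])
  have "ds f t 0 = - (c01 / (3 * c30)) * t \<and> heat_eq c30 c00 c01 F t" if "(t, 0) \<in> I" for t
  proof -
    have "heat_eq c30 c00 c01 F t \<longleftrightarrow> heat_eq c30 c00 c01 (\<lambda>\<tau>. f \<tau> 0) t"
      using that F by (intro heat_eq_cong[OF open_slice_fst[OF open_I, of 0]]) auto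
    then show ?thesis
      using rels[OF that] heat_airy_rel1_slice heat_airy_rel2_slice c30 by blast
  qed
  \<comment> \<open>The recovery steps for an arbitrary \<open>g\<close> are the slice lemmas and
    \<open>heat_eq_iff_det_M3H\<close>; the determinant statement for \<open>F\<close> follows from
    its heat equation.\<close>
  then show ?thesis
    using rels heat_airy_rel1_slice[OF c30] heat_airy_rel2_slice[OF c30] heat_eq_iff_det_M3H[OF c30]
    by (intro conjI ballI allI impI) (auto simp only: split_paired_all prod.case)
qed

end
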